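(* Let $\langle X,X^{\ast}\rangle$ be a dual pair of real vector spaces, let $C\subseteq X$ be convex, let $f:C\to\mathbb{R}$, and let $x\in\operatorname{cor}C$. Then $f$ is a-differentiable at $x$ if and only if $f$ is Gateaux differentiable at $x$. In this case, $[\nabla_a f(x)]=\{\nabla_G f(x)\}$.
   Context: $\operatorname{cor}C$ is the algebraic interior of $C$: the set of $x\in C$ such that for every $y\in X$ there is $\varepsilon>0$ with $x+\varepsilon y\in C$. Affine directional derivative: for $x,y\in C$, $Df(x;y)=\lim_{t\downarrow 0}\frac{f((1-t)x+ty)-f(x)}{t}$, when this limit exists and is finite. $f$ is affinely differentiable (a-differentiable) at $x\in C$ if $Df(x;y)$ exists for all $y\in C$ and $Df(x;\cdot):C\to\mathbb{R}$ is an extendable affine functional, i.e. there are $x^{\ast}\in X^{\ast}$ and $\gamma\in\mathbb{R}$ with $Df(x;y)=\langle y,x^{\ast}\rangle+\gamma$ for all $y\in C$; equivalently (since $Df(x;x)=0$) $Df(x;y)=\langle y-x,x^{\ast}\rangle$ for all $y\in C$. The set of all such $x^{\ast}\in X^{\ast}$ is denoted $[\nabla_a f(x)]$; it is the class $x^{\ast}+(C-x)^{\perp}$, where $A^{\perp}=\{z^{\ast}\in X^{\ast}:\langle z,z^{\ast}\rangle=0\ \forall z\in A\}$. $f$ is Gateaux differentiable at $x\in C$, with Gateaux gradient $\nabla_G f(x)\in X^{\ast}$, if $\lim_{t\to 0^+}\frac{f(x+ty)-f(x)}{t}=\langle y,\nabla_G f(x)\rangle$ for all $y\in X$. *)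

theory Defs
  imports "HOL-Analysis.Analysis"
begin

(* A dual pair of spaces X and X' is given by the types 'a (for X) and 'b (for X') and a pairing
   p x z = <x, z>, which separates the points of both spaces. *)
definition dual_pair :: "('a::real_vector \<Rightarrow> 'b::real_vector \<Rightarrow> real) \<Rightarrow> bool" where
  "dual_pair p \<longleftrightarrow> bilinear p \<and>
     (\<forall>x. x \<noteq> 0 \<longrightarrow> (\<exists>z. p x z \<noteq> 0)) \<and>
     (\<forall>z. z \<noteq> 0 \<longrightarrow> (\<exists>x. p x z \<noteq> 0))"

definition cor :: "'a::real_vector set \<Rightarrow> 'a set" where
  "cor C = {x \<in> C. \<forall>y. \<exists>\<epsilon>>0. x + \<epsilon> *\<^sub>R y \<in> C}"

(* A function f on C is represented by a total function; the notions below depend only on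
   its values on C.  For convex C and x, y in C the affine quotient evaluates f only on C. *)
definition affine_quotient :: "('a::real_vector \<Rightarrow> real) \<Rightarrow> 'a \<Rightarrow> 'a \<Rightarrow> real \<Rightarrow> real" where
  "affine_quotient f x y t = (f ((1 - t) *\<^sub>R x + t *\<^sub>R y) - f x) / t"

definition affine_dderiv_exists :: "('a::real_vector \<Rightarrow> real) \<Rightarrow> 'a \<Rightarrow> 'a \<Rightarrow> bool" where
  "affine_dderiv_exists f x y \<longleftrightarrow> (\<exists>d. (affine_quotient f x y \<longlongrightarrow> d) (at_right 0))"

definition affine_dderiv :: "('a::real_vector \<Rightarrow> real) \<Rightarrow> 'a \<Rightarrow> 'a \<Rightarrow> real" where
  "affine_dderiv f x y = Lim (at_right 0) (affine_quotient f x y)"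

definition has_a_gradient ::
  "('a::real_vector \<Rightarrow> 'b::real_vector \<Rightarrow> real) \<Rightarrow> 'a set \<Rightarrow> ('a \<Rightarrow> real) \<Rightarrow> 'a \<Rightarrow> 'b \<Rightarrow> bool" where
  "has_a_gradient p C f x z \<longleftrightarrow>
     (\<forall>y\<in>C. affine_dderiv_exists f x y) \<and>
     (\<exists>\<gamma>. \<forall>y\<in>C. affine_dderiv f x y = p y z + \<gamma>)"

definition a_differentiable ::
  "('a::real_vector \<Rightarrow> 'b::real_vector \<Rightarrow> real) \<Rightarrow> 'a set \<Rightarrow> ('a \<Rightarrow> real) \<Rightarrow> 'a \<Rightarrow> bool" where
  "a_differentiable p C f x \<longleftrightarrow> x \<in> C \<and> (\<exists>z. has_a_gradient p C f x z)"

definition a_gradients ::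
  "('a::real_vector \<Rightarrow> 'b::real_vector \<Rightarrow> real) \<Rightarrow> 'a set \<Rightarrow> ('a \<Rightarrow> real) \<Rightarrow> 'a \<Rightarrow> 'b set" where
  "a_gradients p C f x = {z. has_a_gradient p C f x z}"

(* The eventual membership says that the difference quotient is defined for small t > 0,
   so that values of f outside C play no role. *)
definition has_gateaux_gradient ::
  "('a::real_vector \<Rightarrow> 'b::real_vector \<Rightarrow> real) \<Rightarrow> 'a set \<Rightarrow> ('a \<Rightarrow> real) \<Rightarrow> 'a \<Rightarrow> 'b \<Rightarrow> bool" where
  "has_gateaux_gradient p C f x z \<longleftrightarrow>
     (\<forall>y. (\<forall>\<^sub>F t in at_right 0. x + t *\<^sub>R y \<in> C) \<and>
          ((\<lambda>t. (f (x + t *\<^sub>R y) - f x) / t) \<longlongrightarrow> p y z) (at_right 0))"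

definition gateaux_differentiable ::
  "('a::real_vector \<Rightarrow> 'b::real_vector \<Rightarrow> real) \<Rightarrow> 'a set \<Rightarrow> ('a \<Rightarrow> real) \<Rightarrow> 'a \<Rightarrow> bool" where
  "gateaux_differentiable p C f x \<longleftrightarrow> x \<in> C \<and> (\<exists>z. has_gateaux_gradient p C f x z)"

(* Unique for a dual pair, since the points of X separate those of X'. *)
definition gateaux_gradient ::
  "('a::real_vector \<Rightarrow> 'b::real_vector \<Rightarrow> real) \<Rightarrow> 'a set \<Rightarrow> ('a \<Rightarrow> real) \<Rightarrow> 'a \<Rightarrow> 'b" where
  "gateaux_gradient p C f x = (THE z. has_gateaux_gradient p C f x z)"

end

theory Submission
  imports Defs
begin

text \<open>The affine quotient towards \<open>y\<close> is the ordinary one-sided difference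
  quotient in the direction \<open>y - x\<close>. A Gateaux gradient \<open>z\<close> therefore
  gives an affine derivative with linear part \<open>z\<close>
  (\<open>gateaux_imp_a_gradient\<close>). Conversely, as \<open>x\<close> lies in
  \<open>cor C\<close>, every direction becomes, after scaling by a positive factor, a direction
  from \<open>x\<close> to a point of \<open>C\<close>; one-sided derivatives are positively
  homogeneous, so the values on \<open>C\<close> determine the limit in all directions
  (\<open>a_gradient_imp_gateaux\<close>). Thus both notions have the same gradients, and the dual
  pair allows at most one (\<open>has_gateaux_gradient_unique\<close>).\<close>

lemma eventually_mem_cor:
  fixes x :: "'a::real_vector"
  assumes "convex C" and "x \<in> cor C"
  shows "\<forall>\<^sub>F t in at_right 0. x + t *\<^sub>R y \<in> C"
proof -
  from assms(2) obtain \<epsilon> where \<epsilon>: "\<epsilon> > 0" "x + \<epsilon> *\<^sub>R y \<in> C" and "x \<in> C"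
    by (auto simp: cor_def)
  have "x + t *\<^sub>R y \<in> C" if "0 < t" "t < \<epsilon>" for t
  proof -
    \<comment> \<open>For \<open>t\<close> below \<epsilon> the point lies on the segment from
      \<open>x\<close> to the point of \<open>C\<close> supplied by \<open>cor\<close>.\<close>
    have "(1 - t / \<epsilon>) *\<^sub>R x + (t / \<epsilon>) *\<^sub>R (x + \<epsilon> *\<^sub>R y) \<in> C"
      using assms(1) \<open>x \<in> C\<close> \<epsilon> that by (intro convexD) auto
    moreover have "(1 - t / \<epsilon>) *\<^sub>R x + (t / \<epsilon>) *\<^sub>R (x + \<epsilon> *\<^sub>R y) = x + t *\<^sub>R y"
      using \<epsilon>(1) by (simp add: algebra_simps)
    ultimately show ?thesis by simp
  qed
  then show ?thesis
    using \<epsilon>(1) by (auto simp: eventually_at_right_field)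
qed

lemma affine_quotient_eq:
  "affine_quotient f x y = (\<lambda>t. (f (x + t *\<^sub>R (y - x)) - f x) / t)"
  by (rule ext) (simp add: affine_quotient_def algebra_simps)

text \<open>This is the change of variable behind positive homogeneity: a positive factor keeps the
  parameter on the right of 0.\<close>

lemma filterlim_divide_at_right_0:
  fixes c :: real
  assumes "c > 0"
  shows "filterlim (\<lambda>t. t / c) (at_right 0) (at_right 0)"
proof -
  have "((\<lambda>t. t / c) \<longlongrightarrow> 0) (at_right 0)"
    using assms by (auto intro!: tendsto_eq_intros)
  then show ?thesis
    using assms by (auto simp: filterlim_at eventually_at_filter)
qed

lemma affine_dderiv_eqI:
  "(affine_quotient f x y \<longlongrightarrow> d) (at_right 0) \<Longrightarrow> affine_dderiv f x y = d"
  unfolding affine_dderiv_def by (rule tendsto_Lim) simp_all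

lemma tendsto_affine_dderiv:
  "affine_dderiv_exists f x y \<Longrightarrow>
    (affine_quotient f x y \<longlongrightarrow> affine_dderiv f x y) (at_right 0)"
  unfolding affine_dderiv_exists_def using affine_dderiv_eqI by blast

lemma affine_dderiv_self: "affine_dderiv f x x = 0"
  by (rule affine_dderiv_eqI) (simp add: affine_quotient_eq)

lemma dual_pair_linear:
  assumes "dual_pair p"
  shows "linear (\<lambda>y. p y z)"
  using assms by (simp add: dual_pair_def bilinear_def)

text \<open>The limit in the direction \<open>y - x\<close> is \<open>p (y - x) z\<close>, and
  linearity splits off the constant \<open>- p x z\<close>, which serves as \<gamma>.\<close>

lemma gateaux_imp_a_gradient:
  assumes "dual_pair p" and "has_gateaux_gradient p C f x z"
  shows "has_a_gradient p C f x z"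
proof -
  have lim: "(affine_quotient f x y \<longlongrightarrow> p (y - x) z) (at_right 0)" for y
    using assms(2) unfolding affine_quotient_eq has_gateaux_gradient_def by blast
  have "affine_dderiv f x y = p y z + - p x z" for y
    using affine_dderiv_eqI[OF lim[of y]] linear_diff[OF dual_pair_linear[OF assms(1)]] by simp
  with lim show ?thesis
    unfolding has_a_gradient_def affine_dderiv_exists_def by blast
qed

lemma a_gradient_imp_gateaux:
  assumes "dual_pair p" and "convex C" and "x \<in> cor C" and "has_a_gradient p C f x z"
  shows "has_gateaux_gradient p C f x z"
  unfolding has_gateaux_gradient_def
proof (intro allI conjI)
  fix y
  show "\<forall>\<^sub>F t in at_right 0. x + t *\<^sub>R y \<in> C"
    using assms(2,3) by (rule eventually_mem_cor)
  interpret linear "\<lambda>y. p y z"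
    using assms(1) by (rule dual_pair_linear)
  from assms(3) obtain \<epsilon> where \<epsilon>: "\<epsilon> > 0" "x + \<epsilon> *\<^sub>R y \<in> C" and "x \<in> C"
    by (auto simp: cor_def)
  from assms(4) obtain \<gamma> where ex: "\<And>w. w \<in> C \<Longrightarrow> affine_dderiv_exists f x w"
    and \<gamma>: "\<And>w. w \<in> C \<Longrightarrow> affine_dderiv f x w = p w z + \<gamma>"
    by (auto simp: has_a_gradient_def)
  \<comment> \<open>The derivative towards \<open>x\<close> itself vanishes, which fixes the
    additive constant and leaves a linear function of \<open>w - x\<close>.\<close>
  have "\<gamma> = - p x z"
    using \<gamma>[OF \<open>x \<in> C\<close>] by (simp add: affine_dderiv_self)
  then have "affine_dderiv f x (x + \<epsilon> *\<^sub>R y) = \<epsilon> * p y z"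
    using \<gamma>[OF \<epsilon>(2)] by (simp add: add scale)
  then have "((\<lambda>t. (f (x + t *\<^sub>R \<epsilon> *\<^sub>R y) - f x) / t) \<longlongrightarrow> \<epsilon> * p y z) (at_right 0)"
    using tendsto_affine_dderiv[OF ex[OF \<epsilon>(2)]] by (simp add: affine_quotient_eq)
  \<comment> \<open>Replacing \<open>t\<close> by \<open>t / \<epsilon>\<close> turns the increment
    into \<open>t *\<^sub>R y\<close> and the quotient into \<epsilon> times the one wanted;
    dividing by \<epsilon> removes the factor.\<close>
  from tendsto_divide[OF filterlim_compose[OF this filterlim_divide_at_right_0[OF \<epsilon>(1)]]
      tendsto_const, of \<epsilon>]
  show "((\<lambda>t. (f (x + t *\<^sub>R y) - f x) / t) \<longlongrightarrow> p y z) (at_right 0)"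
    using \<epsilon>(1) by simp
qed

text \<open>Uniqueness of limits makes both functionals agree on the whole space, and its points
  separate functionals.\<close>

lemma has_gateaux_gradient_unique:
  assumes "dual_pair p" and "has_gateaux_gradient p C f x z" and "has_gateaux_gradient p C f x w"
  shows "z = w"
proof -
  have "p y z = p y w" for y
    using assms(2,3) unfolding has_gateaux_gradient_def
    by (meson tendsto_unique trivial_limit_at_right_real)
  moreover have "linear (p y)" for y
    using assms(1) by (simp add: dual_pair_def bilinear_def)
  ultimately have "p y (z - w) = 0" for y
    by (simp add: linear_diff)
  then show ?thesis
    using assms(1) unfolding dual_pair_def by (metis right_minus_eq)
qed

theorem proposition9:
  fixes p :: "'a::real_vector \<Rightarrow> 'b::real_vector \<Rightarrow> real"
    and C :: "'a set" and f :: "'a \<Rightarrow> real" and x :: 'a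
  assumes "dual_pair p"
    and "convex C"
    and "x \<in> cor C"
  shows "(a_differentiable p C f x \<longleftrightarrow> gateaux_differentiable p C f x) \<and>
         (a_differentiable p C f x \<longrightarrow> a_gradients p C f x = {gateaux_gradient p C f x})"
proof -
  \<comment> \<open>The equivalence holds for each \<open>z\<close> separately, so it also
    identifies the sets of gradients.\<close>
  have iff: "has_a_gradient p C f x z \<longleftrightarrow> has_gateaux_gradient p C f x z" for z
    using a_gradient_imp_gateaux[OF assms] gateaux_imp_a_gradient[OF assms(1)] by blast
  have "a_gradients p C f x = {gateaux_gradient p C f x}"
    if z: "has_gateaux_gradient p C f x z" for z
  proof -
    have "gateaux_gradient p C f x = z"
      unfolding gateaux_gradient_def
      using z has_gateaux_gradient_unique[OF assms(1)] by blast
    then show ?thesis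
      unfolding a_gradients_def iff using z has_gateaux_gradient_unique[OF assms(1)] by blast
  qed
  then show ?thesis
    unfolding a_differentiable_def gateaux_differentiable_def iff by blast
qed

end
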